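(* There exists a Tychonoff space that is $\omega\mathrm{N}$-tight but not $C_2$-tight.
   Context: For a property $\mathcal{P}$ that a subspace of a topological space may have, a space $X$ is called $\mathcal{P}$-tight if for all $x\in X$ and $A\subseteq X$ with $x\in\overline{A}$ there is $B\subseteq A$ such that $x\in\overline{B}$ and $B$ has property $\mathcal{P}$. The properties used are: $\omega\mathrm{N}$: $B$ is countable and nowhere dense in $X$; $C_2$: $B$ is second-countable in the subspace topology. *)

theory Defs
  imports "HOL-Analysis.Analysis"
begin

definition tychonoff_space :: "'a topology \<Rightarrow> bool" where
  "tychonoff_space X \<longleftrightarrow> completely_regular_space X \<and> t1_space X"

definition nowhere_dense_in :: "'a topology \<Rightarrow> 'a set \<Rightarrow> bool" where
  "nowhere_dense_in X B \<longleftrightarrow>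
     B \<subseteq> topspace X \<and> X interior_of (X closure_of B) = {}"

text \<open>The property \<open>P\<close> takes the ambient space as an argument, since it may depend on how the
  subspace sits in the space (as nowhere density does).\<close>

definition tight_space :: "('a topology \<Rightarrow> 'a set \<Rightarrow> bool) \<Rightarrow> 'a topology \<Rightarrow> bool" where
  "tight_space P X \<longleftrightarrow>
     (\<forall>x\<in>topspace X. \<forall>A\<subseteq>topspace X. x \<in> X closure_of A \<longrightarrow>
        (\<exists>B\<subseteq>A. x \<in> X closure_of B \<and> P X B))"

definition omega_N :: "'a topology \<Rightarrow> 'a set \<Rightarrow> bool" where
  "omega_N X B \<longleftrightarrow> countable B \<and> nowhere_dense_in X B"

definition C2 :: "'a topology \<Rightarrow> 'a set \<Rightarrow> bool" where
  "C2 X B \<longleftrightarrow> second_countable (subtopology X B)"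

end

(* The space is a product Z x T. The factor T, a countable power of an uncountable discrete space,
   is first countable and all its countable subsets are nowhere dense. Hence, for a countable Z,
   the product is countably tight and all its countable subsets are nowhere dense. It contains
   a copy of Z, so it suffices that Z is countable, Tychonoff and not C2-tight.

   Z is a set of 0-1 functions on the power set of the natural numbers. Take an independent family
   of sets E_S of naturals, indexed by the sets S of naturals, and add S to E_S whenever S is
   nowhere dense ("negligible") in the topology generated by the sets E_S and their complements.
   The family C_S so obtained is still independent, and it has no new negligible sets. Z consists
   of the functions f_a = (S |-> [a in C_S]), for a natural, together with the zero function, which
   is a limit of the others by independence. If the f_a with a in D form a second countable space,
   then D is negligible, hence contained in C_D, and the coordinate D separates the zero function
   from all these f_a. *)

theory Submission
  imports Defs
begin

section \<open>Independent families and the absorption of negligible sets\<close>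

text \<open>For finite \<open>P\<close> and \<open>N\<close> these are the basic open sets of the
  topology generated by the sets \<open>E i\<close> and their complements.\<close>

definition pattern :: "('i \<Rightarrow> 'a set) \<Rightarrow> 'i set \<Rightarrow> 'i set \<Rightarrow> 'a set" where
  "pattern E P N = {a. (\<forall>i\<in>P. a \<in> E i) \<and> (\<forall>i\<in>N. a \<notin> E i)}"

definition admissible :: "'i set \<Rightarrow> 'i set \<Rightarrow> bool" where
  "admissible P N \<longleftrightarrow> finite P \<and> finite N \<and> P \<inter> N = {}"

definition independent_family :: "('i \<Rightarrow> 'a set) \<Rightarrow> bool" where
  "independent_family E \<longleftrightarrow> (\<forall>P N. admissible P N \<longrightarrow> pattern E P N \<noteq> {})"

text \<open>When \<open>E\<close> is independent, the admissible patterns are exactly the nonempty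
  basic open sets, and this is nowhere density. The combinatorial form makes sense before
  independence is known.\<close>

definition negligible :: "('i \<Rightarrow> 'a set) \<Rightarrow> 'a set \<Rightarrow> bool" where
  "negligible E D \<longleftrightarrow> (\<forall>P N. admissible P N \<longrightarrow>
     (\<exists>P' N'. P \<subseteq> P' \<and> N \<subseteq> N' \<and> admissible P' N' \<and> pattern E P' N' \<inter> D = {}))"

text \<open>The indices are subsets of the ground set, which permits a diagonal choice: a negligible
  \<open>S\<close> ends up inside the member that it indexes.\<close>

definition absorb :: "('a set \<Rightarrow> 'a set) \<Rightarrow> 'a set \<Rightarrow> 'a set" where
  "absorb E S = (if negligible E S then E S \<union> S else E S)"

lemma pattern_antimono: "P \<subseteq> P' \<Longrightarrow> N \<subseteq> N' \<Longrightarrow> pattern E P' N' \<subseteq> pattern E P N"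
  by (auto simp: pattern_def)

lemma negligible_empty: "negligible E {}"
  by (auto simp: negligible_def)

lemma negligible_Un:
  assumes "negligible E A" "negligible E B"
  shows "negligible E (A \<union> B)"
  unfolding negligible_def
proof (intro allI impI)
  fix P N :: "'a set" assume "admissible P N"
  then obtain P1 N1 where 1: "P \<subseteq> P1" "N \<subseteq> N1" "admissible P1 N1" "pattern E P1 N1 \<inter> A = {}"
    using assms(1) unfolding negligible_def by meson
  then obtain P2 N2 where 2: "P1 \<subseteq> P2" "N1 \<subseteq> N2" "admissible P2 N2" "pattern E P2 N2 \<inter> B = {}"
    using assms(2) unfolding negligible_def by meson
  have "pattern E P2 N2 \<inter> (A \<union> B) = {}"
    using 1 2 pattern_antimono[of P1 P2 N1 N2 E] by blast
  then show "\<exists>P' N'. P \<subseteq> P' \<and> N \<subseteq> N' \<and> admissible P' N' \<and> pattern E P' N' \<inter> (A \<union> B) = {}"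
    using 1 2 by (meson subset_trans)
qed

lemma negligible_Union:
  "finite \<D> \<Longrightarrow> (\<And>D. D \<in> \<D> \<Longrightarrow> negligible E D) \<Longrightarrow> negligible E (\<Union>\<D>)"
  by (induction \<D> rule: finite_induct) (auto simp: negligible_empty negligible_Un)

lemma negligible_absorbed:
  "finite N \<Longrightarrow> negligible E (\<Union>{S \<in> N. negligible E S})"
  by (rule negligible_Union) auto

text \<open>Absorption only enlarges members, so the conditions from \<open>P\<close> survive; a
  condition from \<open>N\<close> can break only at a point of an absorbed set indexed by
  \<open>N\<close>.\<close>

lemma pattern_absorb:
  "pattern E P N - \<Union>{S \<in> N. negligible E S} \<subseteq> pattern (absorb E) P N"
  by (auto simp: pattern_def absorb_def)

text \<open>The sets absorbed by the finitely many members in \<open>N\<close> have a negligible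
  union. Some finer pattern of \<open>E\<close> avoids this union, and its points lie in the
  required pattern of the new family.\<close>

lemma independent_family_absorb:
  assumes "independent_family E"
  shows "independent_family (absorb E)"
  unfolding independent_family_def
proof (intro allI impI)
  fix P N :: "'a set set" assume adm: "admissible P N"
  let ?D = "\<Union>{S \<in> N. negligible E S}"
  have "negligible E ?D"
    using adm by (simp add: admissible_def negligible_absorbed)
  then obtain P' N' where *: "P \<subseteq> P'" "N \<subseteq> N'" "admissible P' N'" "pattern E P' N' \<inter> ?D = {}"
    using adm unfolding negligible_def by meson
  then have "pattern E P' N' \<noteq> {}"
    using assms by (simp add: independent_family_def)
  then show "pattern (absorb E) P N \<noteq> {}"
    using * pattern_antimono[OF *(1,2), of E] pattern_absorb[of E P N] by blast
qed

text \<open>A pattern of the new family missing \<open>D\<close> contains the pattern of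
  \<open>E\<close> with the same indices, up to a negligible set. A further refinement avoids that
  set and therefore misses \<open>D\<close> as well.\<close>

lemma negligible_absorb_imp:
  assumes "negligible (absorb E) D"
  shows "negligible E D"
  unfolding negligible_def
proof (intro allI impI)
  fix P N :: "'a set set" assume "admissible P N"
  then obtain P1 N1 where 1: "P \<subseteq> P1" "N \<subseteq> N1" "admissible P1 N1"
      "pattern (absorb E) P1 N1 \<inter> D = {}"
    using assms unfolding negligible_def by meson
  let ?D = "\<Union>{S \<in> N1. negligible E S}"
  have "negligible E ?D"
    using 1 by (simp add: admissible_def negligible_absorbed)
  then obtain P2 N2 where 2: "P1 \<subseteq> P2" "N1 \<subseteq> N2" "admissible P2 N2" "pattern E P2 N2 \<inter> ?D = {}"
    using 1 unfolding negligible_def by meson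
  have "pattern E P2 N2 \<inter> D = {}"
    using 1 2 pattern_antimono[OF 2(1,2), of E] pattern_absorb[of E P1 N1] by blast
  then show "\<exists>P' N'. P \<subseteq> P' \<and> N \<subseteq> N' \<and> admissible P' N' \<and> pattern E P' N' \<inter> D = {}"
    using 1 2 by (meson subset_trans)
qed

section \<open>An independent family of sets of naturals\<close>

text \<open>Each pair of distinct members differs at some number; finitely many such numbers have a
  common strict bound.\<close>

lemma ex_nat_separating_finite_family:
  fixes \<F> :: "nat set set"
  assumes "finite \<F>"
  shows "\<exists>k. \<forall>S\<in>\<F>. \<forall>T\<in>\<F>. (\<forall>i<k. i \<in> S \<longleftrightarrow> i \<in> T) \<longrightarrow> S = T"
proof -
  have "\<forall>p \<in> \<F> \<times> \<F>. \<exists>i. fst p \<noteq> snd p \<longrightarrow> (i \<in> fst p \<longleftrightarrow> i \<notin> snd p)"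
    by auto
  then obtain d where d: "\<And>p. p \<in> \<F> \<times> \<F> \<Longrightarrow> fst p \<noteq> snd p \<Longrightarrow> (d p \<in> fst p \<longleftrightarrow> d p \<notin> snd p)"
    by metis
  have fin: "finite (d ` (\<F> \<times> \<F>))"
    using assms by auto
  then obtain k where k: "\<And>p. p \<in> \<F> \<times> \<F> \<Longrightarrow> d p < k"
    using finite_nat_set_iff_bounded by (metis image_eqI)
  show ?thesis
  proof (intro exI ballI impI)
    fix S T assume ST: "S \<in> \<F>" "T \<in> \<F>" "\<forall>i<k. i \<in> S \<longleftrightarrow> i \<in> T"
    then show "S = T"
      using d[of "(S, T)"] k[of "(S, T)"] by auto
  qed
qed

text \<open>The ground set is the countable set of pairs of a length \<open>k\<close> and a finite list of 0-1 words;
  such a pair lies in the member indexed by \<open>S\<close> iff \<open>S\<close> restricted to \<open>k\<close> is one of the words.\<close>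

lemma ex_independent_family_nat: "\<exists>E :: nat set \<Rightarrow> nat set. independent_family E"
proof -
  define r where "r S k = map (\<lambda>i. i \<in> S) [0..<k]" for S :: "nat set" and k
  define E where "E S = {n. case from_nat n of (k, L) \<Rightarrow> r S k \<in> set (L :: bool list list)}" for S
  have "pattern E P N \<noteq> {}" if adm: "admissible P N" for P N
  proof -
    have "finite (P \<union> N)"
      using adm by (auto simp: admissible_def)
    then obtain k where "\<forall>S\<in>P \<union> N. \<forall>T\<in>P \<union> N. (\<forall>i<k. i \<in> S \<longleftrightarrow> i \<in> T) \<longrightarrow> S = T"
      using ex_nat_separating_finite_family by meson
    then have k: "\<And>S T. S \<in> P \<union> N \<Longrightarrow> T \<in> P \<union> N \<Longrightarrow> r S k = r T k \<Longrightarrow> S = T"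
      by (auto simp: r_def)
    \<comment> \<open>The words in \<open>L\<close> are the restrictions of the members of
      \<open>P\<close>. Since \<open>k\<close> separates \<open>P \<union> N\<close>, no member of
      \<open>N\<close> restricts to one of them.\<close>
    obtain L where L: "set L = (\<lambda>S. r S k) ` P"
      using adm finite_list[of "(\<lambda>S. r S k) ` P"] by (auto simp: admissible_def)
    have "to_nat (k, L) \<in> pattern E P N"
      using adm k by (fastforce simp: pattern_def E_def L admissible_def)
    then show ?thesis
      by blast
  qed
  then show ?thesis
    by (auto simp: independent_family_def)
qed

section \<open>Powers of discrete spaces and second countable traces\<close>

lemma closure_of_meets_open:
  "x \<in> X closure_of S \<Longrightarrow> openin X U \<Longrightarrow> x \<in> U \<Longrightarrow> S \<inter> U \<noteq> {}"
  by (auto simp: in_closure_of)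

abbreviation discrete_power :: "('i \<Rightarrow> 'b) topology" where
  "discrete_power \<equiv> product_topology (\<lambda>_. discrete_topology UNIV) UNIV"

text \<open>Singletons of a discrete factor are open, so the sets fixing finitely many coordinates
  form a base.\<close>

lemma openin_discrete_power:
  "openin discrete_power U \<longleftrightarrow> (\<forall>x\<in>U. \<exists>J. finite J \<and> {y. \<forall>j\<in>J. y j = x j} \<subseteq> U)"
  (is "?L \<longleftrightarrow> ?R")
proof
  assume ?L
  show ?R
  proof
    fix x assume "x \<in> U"
    then obtain V where V: "finite {i. V i \<noteq> UNIV}" "x \<in> Pi\<^sub>E UNIV V" "Pi\<^sub>E UNIV V \<subseteq> U"
      using \<open>?L\<close> by (auto simp: openin_product_topology_alt)
    have "{y. \<forall>j\<in>{i. V i \<noteq> UNIV}. y j = x j} \<subseteq> Pi\<^sub>E UNIV V"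
    proof
      fix y assume y: "y \<in> {y. \<forall>j\<in>{i. V i \<noteq> UNIV}. y j = x j}"
      have "y i \<in> V i" for i
        using y V(2) by (cases "V i = UNIV") (auto simp: PiE_UNIV_domain Pi_iff)
      then show "y \<in> Pi\<^sub>E UNIV V"
        by (auto simp: PiE_UNIV_domain)
    qed
    then show "\<exists>J. finite J \<and> {y. \<forall>j\<in>J. y j = x j} \<subseteq> U"
      using V by (meson subset_trans)
  qed
next
  assume R: ?R
  show ?L
    unfolding openin_product_topology_alt
  proof
    fix x assume "x \<in> U"
    then obtain J where J: "finite J" "{y. \<forall>j\<in>J. y j = x j} \<subseteq> U"
      using R by blast
    let ?V = "\<lambda>i. if i \<in> J then {x i} else UNIV"
    have "finite {i. ?V i \<noteq> UNIV}"
      by (rule finite_subset[OF _ J(1)]) auto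
    moreover have "x \<in> Pi\<^sub>E UNIV ?V"
      by (auto simp: PiE_UNIV_domain)
    moreover have "Pi\<^sub>E UNIV ?V \<subseteq> {y. \<forall>j\<in>J. y j = x j}"
      by (auto simp: PiE_UNIV_domain Pi_iff split: if_splits)
    ultimately show "\<exists>V. finite {i \<in> UNIV. V i \<noteq> topspace (discrete_topology UNIV)} \<and>
        (\<forall>i\<in>UNIV. openin (discrete_topology UNIV) (V i)) \<and> x \<in> Pi\<^sub>E UNIV V \<and> Pi\<^sub>E UNIV V \<subseteq> U"
      using J(2) by (intro exI[of _ ?V]) auto
  qed
qed

lemma openin_discrete_power_cylinder:
  "finite J \<Longrightarrow> openin discrete_power {y. \<forall>j\<in>J. y j = x j}"
  by (auto simp: openin_discrete_power)

lemma tychonoff_discrete_power: "tychonoff_space (subtopology discrete_power S)"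
  unfolding tychonoff_space_def
  by (intro conjI completely_regular_space_subtopology t1_space_subtopology)
    (simp_all add: Hausdorff_imp_t1_space completely_regular_space_product_topology t1_space_product_topology
      completely_regular_space_discrete_topology)

text \<open>A countable base of the trace of a somewhere dense set mentions only countably many
  coordinates; a coordinate outside them can still be prescribed on every basic set.\<close>

lemma not_second_countable_trace:
  fixes C :: "'i \<Rightarrow> 'a set"
  assumes unc: "uncountable (UNIV :: 'i set)" and D: "\<not> negligible C D"
  shows "\<not> second_countable (subtopology discrete_power ((\<lambda>a i. a \<in> C i) ` D))"
proof
  define B where "B = (\<lambda>a i. a \<in> C i) ` D"
  assume "second_countable (subtopology discrete_power ((\<lambda>a i. a \<in> C i) ` D))"
  then have "second_countable (subtopology discrete_power B)"
    by (simp only: B_def)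
  then obtain \<B> where \<B>: "countable \<B> \<and> (\<forall>W\<in>\<B>. openin (subtopology discrete_power B) W) \<and>
      (\<forall>U x. openin (subtopology discrete_power B) U \<and> x \<in> U \<longrightarrow> (\<exists>W\<in>\<B>. x \<in> W \<and> W \<subseteq> U))"
    unfolding second_countable_def by (elim exE)
  then have cB: "countable \<B>"
    and oB: "\<And>W. W \<in> \<B> \<Longrightarrow> openin (subtopology discrete_power B) W"
    and base: "\<And>U x. openin (subtopology discrete_power B) U \<Longrightarrow> x \<in> U \<Longrightarrow> \<exists>W\<in>\<B>. x \<in> W \<and> W \<subseteq> U"
    by simp_all
  obtain P N where adm: "admissible P N"
    and ext: "\<And>P' N'. P \<subseteq> P' \<Longrightarrow> N \<subseteq> N' \<Longrightarrow> admissible P' N' \<Longrightarrow> pattern C P' N' \<inter> D \<noteq> {}"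
    using D unfolding negligible_def by metis
  have extB: "\<exists>b\<in>B. (\<forall>i\<in>P'. b i) \<and> (\<forall>i\<in>N'. \<not> b i)"
    if "P \<subseteq> P'" "N \<subseteq> N'" "admissible P' N'" for P' N'
    using ext[OF that] by (force simp: pattern_def B_def)
  have "\<exists>J b. finite J \<and> (W \<noteq> {} \<longrightarrow> b \<in> W \<and> {y \<in> B. \<forall>j\<in>J. y j = b j} \<subseteq> W)" if W: "W \<in> \<B>" for W
  proof (cases "W = {}")
    case False
    then obtain b where b: "b \<in> W"
      by blast
    obtain U where U: "openin discrete_power U" "W = U \<inter> B"
      using oB[OF W] by (auto simp: openin_subtopology)
    then obtain J where "finite J" "{y. \<forall>j\<in>J. y j = b j} \<subseteq> U"
      using b by (auto simp: openin_discrete_power)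
    then show ?thesis
      using b U by (intro exI[of _ J] exI[of _ b]) auto
  qed auto
  then have "\<forall>W\<in>\<B>. \<exists>J b. finite J \<and> (W \<noteq> {} \<longrightarrow> b \<in> W \<and> {y \<in> B. \<forall>j\<in>J. y j = b j} \<subseteq> W)"
    by (rule ballI)
  then obtain J b
    where "\<forall>W\<in>\<B>. finite (J W) \<and> (W \<noteq> {} \<longrightarrow> b W \<in> W \<and> {y \<in> B. \<forall>j\<in>J W. y j = b W j} \<subseteq> W)"
    unfolding bchoice_iff by (elim exE)
  then have J: "\<And>W. W \<in> \<B> \<Longrightarrow> finite (J W)"
    and b: "\<And>W. W \<in> \<B> \<Longrightarrow> W \<noteq> {} \<Longrightarrow> b W \<in> W \<and> {y \<in> B. \<forall>j\<in>J W. y j = b W j} \<subseteq> W"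
    by simp_all
  have "countable (P \<union> N \<union> (\<Union>W\<in>\<B>. J W))"
    using cB J adm by (auto simp: admissible_def countable_finite)
  then obtain s where s: "s \<notin> P \<union> N \<union> (\<Union>W\<in>\<B>. J W)"
    using unc by (metis UNIV_eq_I)
  obtain e where e: "e \<in> B" "\<forall>i\<in>insert s P. e i" "\<forall>i\<in>N. \<not> e i"
    using extB[of "insert s P" N] adm s by (auto simp: admissible_def)
  \<comment> \<open>Besides \<open>s\<close>, the cylinder fixes the coordinates in \<open>P\<close>
    and \<open>N\<close>, so every point of \<open>W\<close> extends the pattern given by
    \<open>P\<close> and \<open>N\<close>, as \<open>extB\<close> requires.\<close>
  let ?cyl = "{y. \<forall>j\<in>insert s (P \<union> N). y j = e j}"
  have "openin (subtopology discrete_power B) (?cyl \<inter> B)"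
    unfolding openin_subtopology
    using openin_discrete_power_cylinder[of "insert s (P \<union> N)" e] adm
    by (metis admissible_def finite_Un finite_insert)
  then obtain W where W: "W \<in> \<B>" "e \<in> W" "W \<subseteq> ?cyl \<inter> B"
    using base[of "?cyl \<inter> B" e] e by blast
  then have bW: "b W \<in> ?cyl" "{y \<in> B. \<forall>j\<in>J W. y j = b W j} \<subseteq> W"
    using b[of W] by auto
  let ?K = "J W \<union> P \<union> N"
  have sK: "s \<notin> ?K"
    using s W by blast
  \<comment> \<open>The new point copies \<open>b W\<close> on \<open>?K\<close>, which forces it
    into \<open>W\<close>, but is false at \<open>s\<close>, where all points of \<open>?cyl\<close>
    are true.\<close>
  have "\<exists>y\<in>B. (\<forall>i\<in>{i\<in>?K. b W i}. y i) \<and> (\<forall>i\<in>insert s {i\<in>?K. \<not> b W i}. \<not> y i)"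
    using bW(1) e adm J[OF W(1)] sK by (intro extB) (auto simp: admissible_def)
  then obtain y where y: "y \<in> B" "\<forall>i\<in>?K. y i = b W i" "\<not> y s"
    by blast
  then have "y \<in> ?cyl"
    using bW(2) W(3) by blast
  then show False
    using y(3) e(2) by auto
qed

section \<open>The countable space that is not \<open>C2\<close>-tight\<close>

lemma uncountable_nat_sets: "uncountable (UNIV :: nat set set)"
  by (metis uncountable_UNIV_real countable_lepoll eqpoll_imp_lepoll eqpoll_sym
      nat_sets_eqpoll_reals)

lemma ex_countable_not_C2_tight:
  "\<exists>Z :: (nat set \<Rightarrow> bool) topology.
     tychonoff_space Z \<and> countable (topspace Z) \<and> \<not> tight_space C2 Z"
proof -
  obtain E :: "nat set \<Rightarrow> nat set" where E: "independent_family E"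
    using ex_independent_family_nat by blast
  define C where "C = absorb E"
  define \<phi> where "\<phi> = (\<lambda>(a::nat) i. a \<in> C i)"
  define o0 :: "nat set \<Rightarrow> bool" where "o0 = (\<lambda>_. False)"
  define S where "S = insert o0 (range \<phi>)"
  define Z where "Z = subtopology discrete_power S"
  have indep: "independent_family C"
    unfolding C_def by (rule independent_family_absorb[OF E])
  have top: "topspace Z = S"
    by (simp add: Z_def)
  have "o0 \<in> Z closure_of (range \<phi>)"
    unfolding in_closure_of top
  proof (intro conjI allI impI)
    show "o0 \<in> S"
      by (simp add: S_def)
    fix T assume T: "o0 \<in> T \<and> openin Z T"
    then obtain U where U: "openin discrete_power U" "T = U \<inter> S"
      by (auto simp: Z_def openin_subtopology)
    then obtain J where J: "finite J" "{y. \<forall>j\<in>J. y j = o0 j} \<subseteq> U"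
      using T by (auto simp: openin_discrete_power)
    \<comment> \<open>Independence supplies a point \<open>\<phi> a\<close> that vanishes on the
      finitely many coordinates in \<open>J\<close>, hence lies in the given neighbourhood of
      zero.\<close>
    have "pattern C {} J \<noteq> {}"
      using indep J(1) by (auto simp: independent_family_def admissible_def)
    then obtain a where "\<forall>j\<in>J. a \<notin> C j"
      by (auto simp: pattern_def)
    then have "\<phi> a \<in> U"
      using J(2) by (auto simp: \<phi>_def o0_def)
    then show "\<exists>y. y \<in> range \<phi> \<and> y \<in> T"
      using U by (auto simp: S_def)
  qed
  moreover have "o0 \<notin> Z closure_of B" if B: "B \<subseteq> range \<phi>" "C2 Z B" for B
  proof -
    obtain D where D: "B = \<phi> ` D"
      using B(1) by (meson subset_imageE)
    have "S \<inter> B = B"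
      using B(1) by (auto simp: S_def)
    then have "second_countable (subtopology discrete_power B)"
      using B(2) by (simp add: C2_def Z_def subtopology_subtopology)
    then have "negligible C D"
      using not_second_countable_trace[OF uncountable_nat_sets, of C D] unfolding D \<phi>_def by blast
    then have "negligible E D"
      unfolding C_def by (rule negligible_absorb_imp)
    \<comment> \<open>This is the diagonal step: \<open>D\<close> serves both as a set of naturals
      and as an index, and being negligible for \<open>E\<close> it was absorbed into its own
      member.\<close>
    then have sub: "D \<subseteq> C D"
      by (auto simp: C_def absorb_def)
    \<comment> \<open>At coordinate \<open>D\<close> the zero function is false, whereas
      \<open>\<phi> a\<close> is true for every \<open>a\<close> in \<open>D\<close>.\<close>
    let ?U = "{y. \<forall>j\<in>{D}. y j = o0 j}"
    have "openin Z (?U \<inter> S)"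
      unfolding Z_def openin_subtopology
      using openin_discrete_power_cylinder[of "{D}" o0] by blast
    moreover have "o0 \<in> ?U \<inter> S"
      by (simp add: S_def)
    moreover have "?U \<inter> S \<inter> B = {}"
      using sub by (auto simp: D \<phi>_def o0_def)
    ultimately show ?thesis
      using closure_of_meets_open[of o0 Z B "?U \<inter> S"] by (metis Int_commute)
  qed
  ultimately have "\<not> tight_space C2 Z"
    unfolding tight_space_def top by (auto simp: S_def)
  moreover have "countable (topspace Z)"
    by (simp add: top S_def)
  ultimately show ?thesis
    using tychonoff_discrete_power unfolding Z_def by blast
qed

section \<open>The discrete power as a factor and the tightness of products\<close>

lemma first_countable_discrete_power: "first_countable (discrete_power :: (nat \<Rightarrow> 'b) topology)"
  unfolding first_countable_def
proof
  fix x :: "nat \<Rightarrow> 'b"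
  let ?\<B> = "range (\<lambda>n. {y. \<forall>j\<in>{..<n}. y j = x j})"
  have "\<exists>V\<in>?\<B>. x \<in> V \<and> V \<subseteq> U" if U: "openin discrete_power U" "x \<in> U" for U
  proof -
    obtain J where J: "finite J" "{y. \<forall>j\<in>J. y j = x j} \<subseteq> U"
      using U by (auto simp: openin_discrete_power)
    then obtain n where "J \<subseteq> {..<n}"
      using finite_nat_iff_bounded by blast
    then have "{y. \<forall>j\<in>{..<n}. y j = x j} \<subseteq> U"
      using J(2) by blast
    then show ?thesis
      by blast
  qed
  then show "\<exists>\<B>. countable \<B> \<and> (\<forall>V\<in>\<B>. openin discrete_power V) \<and>
      (\<forall>U. openin discrete_power U \<and> x \<in> U \<longrightarrow> (\<exists>V\<in>\<B>. x \<in> V \<and> V \<subseteq> U))"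
    by (intro exI[of _ ?\<B>]) (auto intro!: openin_discrete_power_cylinder)
qed

text \<open>A nonempty open set leaves some coordinate free. The countable set \<open>N\<close>
  takes only countably many values there, so changing that coordinate to another value leads out of
  the closure of \<open>N\<close>.\<close>

lemma countable_imp_nowhere_dense_discrete_power:
  fixes N :: "(nat \<Rightarrow> 'b) set"
  assumes unc: "uncountable (UNIV :: 'b set)" and N: "countable N"
  shows "nowhere_dense_in discrete_power N"
proof -
  have "x \<notin> discrete_power interior_of (discrete_power closure_of N)" for x :: "nat \<Rightarrow> 'b"
  proof
    assume "x \<in> discrete_power interior_of (discrete_power closure_of N)"
    then obtain U where U: "openin discrete_power U" "x \<in> U" "U \<subseteq> discrete_power closure_of N"
      by (auto simp: interior_of_def)
    then obtain J where J: "finite J" "{y. \<forall>j\<in>J. y j = x j} \<subseteq> U"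
      by (auto simp: openin_discrete_power)
    obtain n where n: "n \<notin> J"
      using J(1) ex_new_if_finite infinite_UNIV_nat by blast
    obtain r where r: "r \<notin> (\<lambda>s. s n) ` N"
      using unc N by (metis UNIV_eq_I countable_image)
    let ?x = "x(n := r)"
    have "?x \<in> discrete_power closure_of N"
    proof -
      have "?x \<in> {y. \<forall>j\<in>J. y j = x j}"
        using n by auto
      then show ?thesis
        using U(3) J(2) by blast
    qed
    moreover have "openin discrete_power {y. \<forall>j\<in>{n}. y j = ?x j}"
      by (rule openin_discrete_power_cylinder) simp
    moreover have "?x \<in> {y. \<forall>j\<in>{n}. y j = ?x j}"
      by simp
    ultimately have "N \<inter> {y. \<forall>j\<in>{n}. y j = ?x j} \<noteq> {}"
      by (rule closure_of_meets_open)
    then obtain y where "y \<in> N" "y n = r"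
      by auto
    then show False
      using r by blast
  qed
  then show ?thesis
    by (auto simp: nowhere_dense_in_def)
qed

text \<open>For each of the countably many points \<open>w\<close> of \<open>Z\<close> and each set
  \<open>V\<close> of a countable base at \<open>t\<close>, one point of \<open>A\<close> over
  \<open>w\<close> with second coordinate in \<open>V\<close> is kept, if there is one. The result
  is nowhere dense because its projection to \<open>T\<close> is countable.\<close>

lemma omega_N_tight_prod_topology:
  assumes Z: "countable (topspace Z)" and T: "first_countable T"
    and nwd: "\<And>N. countable N \<Longrightarrow> N \<subseteq> topspace T \<Longrightarrow> nowhere_dense_in T N"
  shows "tight_space omega_N (prod_topology Z T)"
  unfolding tight_space_def
proof (intro ballI allI impI)
  fix x A assume xZ: "x \<in> topspace (prod_topology Z T)" and A: "A \<subseteq> topspace (prod_topology Z T)"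
    and cl: "x \<in> prod_topology Z T closure_of A"
  obtain z t where x: "x = (z, t)" "z \<in> topspace Z" "t \<in> topspace T"
    using xZ by auto
  have "\<exists>\<B>. countable \<B> \<and> (\<forall>V\<in>\<B>. openin T V) \<and>
      (\<forall>U. openin T U \<and> t \<in> U \<longrightarrow> (\<exists>V\<in>\<B>. t \<in> V \<and> V \<subseteq> U))"
    using T x(3) unfolding first_countable_def by (rule bspec)
  then obtain \<B> where "countable \<B> \<and> (\<forall>V\<in>\<B>. openin T V) \<and>
      (\<forall>U. openin T U \<and> t \<in> U \<longrightarrow> (\<exists>V\<in>\<B>. t \<in> V \<and> V \<subseteq> U))"
    by (elim exE)
  then have \<B>: "countable \<B>" "\<And>V. V \<in> \<B> \<Longrightarrow> openin T V"
    and base: "\<And>U. openin T U \<Longrightarrow> t \<in> U \<Longrightarrow> \<exists>V\<in>\<B>. t \<in> V \<and> V \<subseteq> U"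
    by simp_all
  define pick where "pick = (\<lambda>(w, V). SOME s. s \<in> V \<and> (w, s) \<in> A)"
  define B where "B = (\<lambda>p. (fst p, pick p)) ` {p \<in> topspace Z \<times> \<B>. \<exists>s\<in>snd p. (fst p, s) \<in> A}"
  have pick: "pick (w, V) \<in> V \<and> (w, pick (w, V)) \<in> A" if "s \<in> V" "(w, s) \<in> A" for w V s
    unfolding pick_def prod.case by (rule someI) (use that in blast)
  have BA: "B \<subseteq> A"
    using pick by (auto simp: B_def)
  have cB: "countable B"
    unfolding B_def
  proof (rule countable_image, rule countable_subset)
    show "countable (topspace Z \<times> \<B>)"
      using Z \<B>(1) by simp
  qed auto
  have "x \<in> prod_topology Z T closure_of B"
    unfolding in_closure_of
  proof (intro conjI allI impI)
    fix W assume W: "x \<in> W \<and> openin (prod_topology Z T) W"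
    then obtain U V where UV: "openin Z U" "openin T V" "z \<in> U" "t \<in> V" "U \<times> V \<subseteq> W"
      unfolding openin_prod_topology_alt x(1) by meson
    then obtain V' where V': "V' \<in> \<B>" "t \<in> V'" "V' \<subseteq> V"
      using base by meson
    have "openin (prod_topology Z T) (U \<times> V')"
      using UV V' \<B> by (simp add: openin_prod_Times_iff)
    moreover have "x \<in> U \<times> V'"
      using x(1) UV(3) V'(2) by simp
    ultimately have "A \<inter> (U \<times> V') \<noteq> {}"
      using cl by (intro closure_of_meets_open)
    then obtain w s where ws: "(w, s) \<in> A" "w \<in> U" "s \<in> V'"
      by auto
    \<comment> \<open>The kept point may differ from \<open>(w, s)\<close>, but it has the same
      first coordinate and its second coordinate still lies in \<open>V'\<close>.\<close>
    have "(w, pick (w, V')) \<in> B"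
      using ws V'(1) A by (force simp: B_def)
    moreover have "(w, pick (w, V')) \<in> W"
      using pick[OF ws(3,1)] ws UV(5) V'(3) by blast
    ultimately show "\<exists>y. y \<in> B \<and> y \<in> W"
      by blast
  qed (rule xZ)
  moreover have "nowhere_dense_in (prod_topology Z T) B"
  proof -
    have "snd ` B \<subseteq> topspace T"
      using BA A by auto
    then have "T interior_of (T closure_of (snd ` B)) = {}"
      using nwd[of "snd ` B"] cB by (simp add: nowhere_dense_in_def)
    \<comment> \<open>Closure and interior of a rectangle are taken factorwise, so an empty interior
      in \<open>T\<close> makes the whole interior empty.\<close>
    then have "prod_topology Z T interior_of (prod_topology Z T closure_of (topspace Z \<times> snd ` B)) = {}"
      by (simp add: closure_of_Times interior_of_Times)
    moreover have "B \<subseteq> topspace Z \<times> snd ` B"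
      using BA A by (auto simp: image_iff) (metis snd_conv)
    ultimately show ?thesis
      unfolding nowhere_dense_in_def
      using interior_of_mono[OF closure_of_mono] BA A by blast
  qed
  ultimately show "\<exists>B\<subseteq>A. x \<in> prod_topology Z T closure_of B \<and> omega_N (prod_topology Z T) B"
    using BA cB unfolding omega_N_def by blast
qed

text \<open>The slice at \<open>t\<close> is a copy of \<open>Z\<close>: \<open>A\<close> is lifted
  to \<open>A \<times> {t}\<close>, and the second countable subset found there is projected
  back.\<close>

lemma C2_tight_prod_topology_imp:
  assumes tight: "tight_space C2 (prod_topology Z T)" and t: "t \<in> topspace T"
  shows "tight_space C2 Z"
  unfolding tight_space_def
proof (intro ballI allI impI)
  fix x A assume x: "x \<in> topspace Z" and A: "A \<subseteq> topspace Z" and cl: "x \<in> Z closure_of A"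
  have "(x, t) \<in> prod_topology Z T closure_of (A \<times> {t})"
    using cl t closure_of_subset[of "{t}" T] by (auto simp: closure_of_Times)
  then obtain B where B: "B \<subseteq> A \<times> {t}" "(x, t) \<in> prod_topology Z T closure_of B"
      "C2 (prod_topology Z T) B"
    using tight x A t unfolding tight_space_def
    by (metis Sigma_mono SigmaI empty_subsetI insert_subset topspace_prod_topology)
  then have eq: "B = fst ` B \<times> {t}"
    by force
  have "x \<in> Z closure_of (fst ` B)"
    using B(2) by (subst (asm) eq) (simp add: closure_of_Times)
  moreover have "second_countable (prod_topology (subtopology Z (fst ` B)) (subtopology T {t}))"
    using B(3) unfolding C2_def by (subst (asm) eq) (simp add: subtopology_Times)
  then have "C2 Z (fst ` B)"
    unfolding C2_def
    using homeomorphic_space_second_countability[OF homeomorphic_space_prod_topology_sing1[OF t]]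
    by blast
  ultimately show "\<exists>B\<subseteq>A. x \<in> Z closure_of B \<and> C2 Z B"
    using B(1) by (intro exI[of _ "fst ` B"]) auto
qed

section \<open>Transport along homeomorphisms and to the type \<open>real set\<close>\<close>

text \<open>Separate predicates \<open>P\<close> and \<open>Q\<close> are used because the two
  spaces may have points of different types; both become instances of one polymorphic
  property.\<close>

lemma tight_space_homeomorphic_map:
  assumes hom: "homeomorphic_map X Y h" and tight: "tight_space P X"
    and inv: "\<And>B. B \<subseteq> topspace X \<Longrightarrow> P X B \<Longrightarrow> Q Y (h ` B)"
  shows "tight_space Q Y"
  unfolding tight_space_def
proof (intro ballI allI impI)
  fix y A assume y: "y \<in> topspace Y" and A: "A \<subseteq> topspace Y" and cl: "y \<in> Y closure_of A"
  have im: "h ` topspace X = topspace Y" and inj: "inj_on h (topspace X)"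
    using hom by (auto simp: homeomorphic_eq_everything_map)
  define A' where "A' = {x \<in> topspace X. h x \<in> A}"
  have A': "A' \<subseteq> topspace X" "h ` A' = A"
    using A im by (auto simp: A'_def)
  obtain x where x: "x \<in> X closure_of A'" "y = h x"
    using cl homeomorphic_map_closure_of[OF hom A'(1)] A'(2) by auto
  have "x \<in> topspace X"
    using x(1) by (simp add: in_closure_of)
  then obtain B where B: "B \<subseteq> A'" "x \<in> X closure_of B" "P X B"
    using tight A'(1) x(1) unfolding tight_space_def by meson
  then have "y \<in> Y closure_of (h ` B)"
    using homeomorphic_map_closure_of[OF hom, of B] A'(1) x(2) by auto
  then show "\<exists>B\<subseteq>A. y \<in> Y closure_of B \<and> Q Y B"
    using B A' inv[of B] by (intro exI[of _ "h ` B"]) auto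
qed

lemma omega_N_homeomorphic_map:
  assumes hom: "homeomorphic_map X Y h" and B: "B \<subseteq> topspace X" "omega_N X B"
  shows "omega_N Y (h ` B)"
proof -
  have "Y interior_of (Y closure_of (h ` B)) = h ` (X interior_of (X closure_of B))"
    using hom B(1)
    by (simp add: homeomorphic_map_closure_of homeomorphic_map_interior_of closure_of_subset_topspace)
  moreover have "h ` B \<subseteq> topspace Y"
    using hom B(1) by (auto simp: homeomorphic_eq_everything_map)
  ultimately show ?thesis
    using B(2) by (simp add: omega_N_def nowhere_dense_in_def)
qed

lemma C2_homeomorphic_map:
  assumes hom: "homeomorphic_map X Y h" and B: "B \<subseteq> topspace X" "C2 X B"
  shows "C2 Y (h ` B)"
proof -
  have "h ` (topspace X \<inter> B) = topspace Y \<inter> h ` B"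
    using hom B(1) by (auto simp: homeomorphic_eq_everything_map)
  then have "subtopology X B homeomorphic_space subtopology Y (h ` B)"
    by (rule homeomorphic_map_imp_homeomorphic_space[OF homeomorphic_map_subtopologies[OF hom]])
  then show ?thesis
    using B(2) homeomorphic_space_second_countability by (auto simp: C2_def)
qed

lemma inj_imp_homeomorphic_map_pullback:
  assumes "inj h"
  shows "homeomorphic_map X (pullback_topology (range h) (inv h) X) h"
proof -
  have top: "topspace (pullback_topology (range h) (inv h) X) = h ` topspace X"
    using assms by (force simp: topspace_pullback_topology)
  have "continuous_map X (pullback_topology (range h) (inv h) X) h"
    by (rule continuous_map_pullback') (use assms in \<open>auto simp: comp_def\<close>)
  moreover have "continuous_map (pullback_topology (range h) (inv h) X) X (inv h)"
    using continuous_map_pullback[OF continuous_map_id, of "range h" "inv h" X] by simp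
  ultimately show ?thesis
    unfolding homeomorphic_map_maps homeomorphic_maps_def
    using assms top by auto
qed

text \<open>A pair is coded by a set of sets of naturals, and sets of naturals inject into the
  reals. This gives the product a copy on the type \<open>real set\<close>.\<close>

lemma ex_inj_into_real_set:
  "\<exists>h :: (nat set \<Rightarrow> bool) \<times> (nat \<Rightarrow> nat set) \<Rightarrow> real set. inj h"
proof -
  have "(UNIV :: nat set set) \<lesssim> (UNIV :: real set)"
    by (rule eqpoll_imp_lepoll[OF nat_sets_eqpoll_reals])
  then obtain k :: "nat set \<Rightarrow> real" where k: "inj k"
    by (auto simp: lepoll_def)
  define enc where "enc g = {prod_encode (n, m) | n m. m \<in> g n}" for g :: "nat \<Rightarrow> nat set"
  \<comment> \<open>The number 0 is a tag: the members containing 0 code the sets on which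
    \<open>f\<close> is true, and the only member without 0 codes \<open>g\<close>.\<close>
  define c where "c = (\<lambda>(f, g). insert (Suc ` enc g) {insert 0 (Suc ` S) | S. f S})"
  have "f = f' \<and> g = g'" if eq: "c (f, g) = c (f', g')" for f f' g g'
  proof
    have f: "insert 0 (Suc ` S) \<in> c (f, g) \<longleftrightarrow> f S" for f g S
    proof -
      have "insert 0 (Suc ` S) \<noteq> Suc ` enc g"
        by blast
      moreover have "insert 0 (Suc ` S) = insert 0 (Suc ` S') \<longleftrightarrow> S = S'" for S'
        by (simp add: insert_ident inj_image_eq_iff)
      ultimately show ?thesis
        by (auto simp: c_def)
    qed
    show "f = f'"
      using f[of _ f g] f[of _ f' g'] eq by (auto simp: fun_eq_iff)
    have "{Q \<in> c (f, g). 0 \<notin> Q} = {Suc ` enc g}" for f g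
      by (auto simp: c_def)
    then have "Suc ` enc g = Suc ` enc g'"
      using eq by (metis singleton_inject)
    then have "enc g = enc g'"
      by (simp add: inj_image_eq_iff)
    moreover have "m \<in> g n \<longleftrightarrow> prod_encode (n, m) \<in> enc g" for g n m
      by (auto simp: enc_def)
    ultimately show "g = g'"
      by (auto simp: fun_eq_iff)
  qed
  then have "inj c"
    by (auto simp: inj_def)
  then have "inj (\<lambda>p. k ` c p)"
    using k by (auto simp: inj_def inj_image_eq_iff)
  then show ?thesis
    by blast
qed

theorem mainTheorem4:
  shows "\<exists>X :: real set topology. tychonoff_space X \<and> tight_space omega_N X \<and> \<not> tight_space C2 X"
proof -
  obtain Z :: "(nat set \<Rightarrow> bool) topology"
    where Z: "tychonoff_space Z" "countable (topspace Z)" "\<not> tight_space C2 Z"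
    using ex_countable_not_C2_tight by blast
  define T :: "(nat \<Rightarrow> nat set) topology" where "T = discrete_power"
  obtain h :: "(nat set \<Rightarrow> bool) \<times> (nat \<Rightarrow> nat set) \<Rightarrow> real set" where h: "inj h"
    using ex_inj_into_real_set by blast
  let ?X = "prod_topology Z T"
  let ?Y = "pullback_topology (range h) (inv h) ?X"
  have hom: "homeomorphic_map ?X ?Y h"
    using h by (rule inj_imp_homeomorphic_map_pullback)
  then have sp: "?X homeomorphic_space ?Y"
    by (rule homeomorphic_map_imp_homeomorphic_space)
  have "tychonoff_space T"
    using tychonoff_discrete_power[of UNIV] by (simp add: T_def)
  then have "tychonoff_space ?X"
    using Z(1) by (simp add: tychonoff_space_def completely_regular_space_prod_topology
        t1_space_prod_topology)
  then have "tychonoff_space ?Y"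
    using homeomorphic_completely_regular_space[OF sp] homeomorphic_t1_space[OF sp]
    by (simp add: tychonoff_space_def)
  moreover have "tight_space omega_N ?X"
    unfolding T_def
    by (intro omega_N_tight_prod_topology Z(2) first_countable_discrete_power
        countable_imp_nowhere_dense_discrete_power uncountable_nat_sets)
  then have "tight_space omega_N ?Y"
    using omega_N_homeomorphic_map[OF hom] by (rule tight_space_homeomorphic_map[OF hom])
  moreover have "\<not> tight_space C2 ?Y"
  proof
    assume tY: "tight_space C2 ?Y"
    \<comment> \<open>A homeomorphism in the opposite direction brings \<open>C2\<close>-tightness
      back from the copy to the product.\<close>
    obtain h' where hom': "homeomorphic_map ?Y ?X h'"
      using sp homeomorphic_space_sym homeomorphic_space by blast
    have "tight_space C2 ?X"
      using C2_homeomorphic_map[OF hom'] by (rule tight_space_homeomorphic_map[OF hom' tY])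
    \<comment> \<open>Any point of \<open>T\<close> determines a slice; the constant sequence of
      empty sets is an arbitrary choice.\<close>
    then have "tight_space C2 Z"
      by (rule C2_tight_prod_topology_imp[where t = "\<lambda>_. {}"]) (simp add: T_def)
    with Z(3) show False
      by blast
  qed
  ultimately show ?thesis
    by blast
qed

end
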